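(* Let $p$ be a probability distribution on $\mathbb{R}^D$, let $x\in\mathbb{R}^D$ be fixed, let $y\sim p$ be a single sample, and let $w=k(x,y)$. Assume $w\ge 0$, $\Pr(w>0)=1$, $\mathbb{E}[w]\in(0,\infty)$, $\mathbb{E}[\|y\|]<\infty$ and $\mathbb{E}[\|w y\|]<\infty$. Let $T^*=\mathbb{E}[wy]/\mathbb{E}[w]$ be the target centroid and let $T_1$ be the minibatch centroid with minibatch size $n=1$ formed from the single sample $y$. Then $$\mathbb{E}[T_1]-T^* \;=\; -\,\frac{\operatorname{Cov}(w,y)}{\mathbb{E}[w]},$$ where $\operatorname{Cov}(w,y):=\mathbb{E}[(w-\mathbb{E}w)(y-\mathbb{E}y)]\in\mathbb{R}^D$ is the componentwise covariance between the scalar $w$ and the vector $y$.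
   Context: $k:\mathbb{R}^D\times\mathbb{R}^D\to\mathbb{R}$ is a kernel (with $k(x,\cdot)$ measurable, so that $w=k(x,y)$ is a random variable), and $\|\cdot\|$ is the Euclidean norm. For a fixed query $x$ and samples $y_1,\dots,y_n$ with weights $w_i=k(x,y_i)$ such that $\sum_j w_j>0$, the minibatch centroid is $T_n:=\sum_{i=1}^n\alpha_i y_i$ with $\alpha_i=w_i/\sum_{j=1}^n w_j$. In particular, for $n=1$, $T_1=(w/w)\,y$ whenever $w>0$ (an event of probability one under the hypotheses). *)

theory Defs
  imports "HOL-Probability.Probability"
begin

text \<open>Samples are indexed from 1 to n. If the weights sum to 0, division by zero makes every
  normalized weight, and hence the centroid, equal to 0.\<close>

definition centroid_weight ::
  "('a \<Rightarrow> 'a \<Rightarrow> real) \<Rightarrow> 'a \<Rightarrow> nat \<Rightarrow> (nat \<Rightarrow> 'a) \<Rightarrow> nat \<Rightarrow> real" where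
  "centroid_weight k x n y i = k x (y i) / (\<Sum>j=1..n. k x (y j))"

definition minibatch_centroid ::
  "('a::real_vector \<Rightarrow> 'a \<Rightarrow> real) \<Rightarrow> 'a \<Rightarrow> nat \<Rightarrow> (nat \<Rightarrow> 'a) \<Rightarrow> 'a" where
  "minibatch_centroid k x n y = (\<Sum>i=1..n. centroid_weight k x n y i *\<^sub>R y i)"

definition target_centroid ::
  "'s measure \<Rightarrow> ('s \<Rightarrow> real) \<Rightarrow> ('s \<Rightarrow> 'a::{banach, second_countable_topology}) \<Rightarrow> 'a" where
  "target_centroid M w y = (\<integral>\<omega>. w \<omega> *\<^sub>R y \<omega> \<partial>M) /\<^sub>R (\<integral>\<omega>. w \<omega> \<partial>M)"

definition scalar_vector_cov ::
  "'s measure \<Rightarrow> ('s \<Rightarrow> real) \<Rightarrow> ('s \<Rightarrow> 'a::{banach, second_countable_topology}) \<Rightarrow> 'a" where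
  "scalar_vector_cov M w y =
     (\<integral>\<omega>. (w \<omega> - (\<integral>\<omega>'. w \<omega>' \<partial>M)) *\<^sub>R (y \<omega> - (\<integral>\<omega>'. y \<omega>' \<partial>M)) \<partial>M)"

end

theory Submission
  imports Defs
begin

text \<open>A single sample of positive weight is its own centroid, so the centroid equals y almost surely
  and has expectation E[y]; the claim is then Cov(w,y) = E[wy] - E[w] E[y] divided by E[w].\<close>

text \<open>The quotient stays uncancelled on purpose: at weight 0 it is 0, so there the centroid is
  0 and may differ from the sample.\<close>

lemma minibatch_centroid_1: "minibatch_centroid k x 1 y = (k x (y 1) / k x (y 1)) *\<^sub>R y 1"
  by (simp add: minibatch_centroid_def centroid_weight_def)

text \<open>Expanding the product bilinearly leaves four integrable terms, whose cross terms combine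
  to a single \<open>- E[w] E[y]\<close>. Stating this with \<open>has_bochner_integral\<close>
  yields integrability and the value together.\<close>

lemma (in prob_space) has_bochner_integral_scalar_vector_cov:
  fixes y :: "'a \<Rightarrow> 'b::{banach, second_countable_topology}"
  assumes w: "integrable M w" and y: "integrable M y"
    and wy: "integrable M (\<lambda>\<omega>. w \<omega> *\<^sub>R y \<omega>)"
  shows "has_bochner_integral M
    (\<lambda>\<omega>. (w \<omega> - (\<integral>\<omega>'. w \<omega>' \<partial>M)) *\<^sub>R (y \<omega> - (\<integral>\<omega>'. y \<omega>' \<partial>M)))
    ((\<integral>\<omega>. w \<omega> *\<^sub>R y \<omega> \<partial>M) - (\<integral>\<omega>. w \<omega> \<partial>M) *\<^sub>R (\<integral>\<omega>. y \<omega> \<partial>M))"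
proof -
  define a where "a = (\<integral>\<omega>. w \<omega> \<partial>M)"
  define b where "b = (\<integral>\<omega>. y \<omega> \<partial>M)"
  have expand: "(w \<omega> - a) *\<^sub>R (y \<omega> - b)
      = w \<omega> *\<^sub>R y \<omega> - w \<omega> *\<^sub>R b - a *\<^sub>R y \<omega> + a *\<^sub>R b" for \<omega>
    by (simp add: algebra_simps)
  \<comment> \<open>The constant term \<open>a *\<^sub>R b\<close> integrates to itself because M
    has total mass 1; it cancels one of the two cross terms, each of which integrates to its
    negative.\<close>
  show ?thesis
    unfolding a_def[symmetric] b_def[symmetric] expand has_bochner_integral_iff
    using w y wy by (simp add: a_def[symmetric] b_def[symmetric] prob_space)
qed

theorem theorem3p1:
  fixes p :: "(real ^ 'D) measure"
    and M :: "'s measure"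
    and k :: "real ^ 'D \<Rightarrow> real ^ 'D \<Rightarrow> real"
    and x :: "real ^ 'D"
    and y :: "'s \<Rightarrow> real ^ 'D"
    and w :: "'s \<Rightarrow> real"
  assumes p_prob: "prob_space p" and p_borel: "sets p = sets borel"
    and M_prob: "prob_space M"
    and y_measurable: "y \<in> borel_measurable M"
    and y_distributed: "distr M borel y = p"
    and k_measurable: "k x \<in> borel_measurable borel"
    and w_eq: "w = (\<lambda>\<omega>. k x (y \<omega>))"
    and w_nonneg: "AE \<omega> in M. 0 \<le> w \<omega>"
    and w_pos: "\<P>(\<omega> in M. 0 < w \<omega>) = 1"
    and Ew_finite: "integrable M w"
    and Ew_pos: "0 < (\<integral>\<omega>. w \<omega> \<partial>M)"
    and Ey_finite: "integrable M (\<lambda>\<omega>. norm (y \<omega>))"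
    and Ewy_finite: "integrable M (\<lambda>\<omega>. norm (w \<omega> *\<^sub>R y \<omega>))"
  shows "integrable M (\<lambda>\<omega>. minibatch_centroid k x 1 (\<lambda>_. y \<omega>))
    \<and> integrable M (\<lambda>\<omega>. (w \<omega> - (\<integral>\<omega>'. w \<omega>' \<partial>M)) *\<^sub>R (y \<omega> - (\<integral>\<omega>'. y \<omega>' \<partial>M)))
    \<and> (\<integral>\<omega>. minibatch_centroid k x 1 (\<lambda>_. y \<omega>) \<partial>M) - target_centroid M w y
           = - (scalar_vector_cov M w y /\<^sub>R (\<integral>\<omega>. w \<omega> \<partial>M))"
proof -
  interpret prob_space M by (rule M_prob)
  let ?T = "\<lambda>\<omega>. minibatch_centroid k x 1 (\<lambda>_. y \<omega>)"
  have w_meas [measurable]: "w \<in> borel_measurable M"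
    using Ew_finite by simp
  note y_measurable [measurable]
  have T_eq: "?T = (\<lambda>\<omega>. (w \<omega> / w \<omega>) *\<^sub>R y \<omega>)"
    by (simp only: minibatch_centroid_1 w_eq)
  \<comment> \<open>Almost sure equality with y does not by itself give measurability, since M may
    be incomplete; the explicit quotient form does.\<close>
  have T_meas: "?T \<in> borel_measurable M"
    unfolding T_eq by measurable
  have "AE \<omega> in M. 0 < w \<omega>"
    using w_pos by (subst (asm) prob_Collect_eq_1) simp_all
  then have T_AE: "AE \<omega> in M. ?T \<omega> = y \<omega>"
    by eventually_elim (simp add: fun_cong[OF T_eq, simplified])
  have y_int: "integrable M y"
    using Ey_finite by (simp add: integrable_norm_iff)
  \<comment> \<open>Integrability of a norm passes to the function itself once the function is known
    to be measurable.\<close>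
  have wy_int: "integrable M (\<lambda>\<omega>. w \<omega> *\<^sub>R y \<omega>)"
    by (rule integrable_norm_cancel[OF Ewy_finite]) measurable
  have T_int: "integrable M ?T"
    using integrable_cong_AE[OF T_meas y_measurable T_AE] y_int by simp
  have ET: "(\<integral>\<omega>. ?T \<omega> \<partial>M) = (\<integral>\<omega>. y \<omega> \<partial>M)"
    by (rule integral_cong_AE[OF T_meas y_measurable T_AE])
  note cov = has_bochner_integral_scalar_vector_cov[OF Ew_finite y_int wy_int]
  have "scalar_vector_cov M w y
      = (\<integral>\<omega>. w \<omega> *\<^sub>R y \<omega> \<partial>M) - (\<integral>\<omega>. w \<omega> \<partial>M) *\<^sub>R (\<integral>\<omega>. y \<omega> \<partial>M)"
    using cov unfolding scalar_vector_cov_def by (rule has_bochner_integral_integral_eq)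
  \<comment> \<open>Since E[w] is nonzero, dividing the covariance by it turns
    \<open>E[w] E[y]\<close> into E[y] and E[wy] into the target centroid.\<close>
  then have "(\<integral>\<omega>. ?T \<omega> \<partial>M) - target_centroid M w y
      = - (scalar_vector_cov M w y /\<^sub>R (\<integral>\<omega>. w \<omega> \<partial>M))"
    using Ew_pos unfolding ET target_centroid_def by (simp add: scaleR_right_diff_distrib)
  \<comment> \<open>Besides the value, \<open>cov\<close> supplies the integrability of the
    covariance integrand, so that its integral is not the default 0.\<close>
  with T_int cov show ?thesis
    by (simp add: has_bochner_integral_iff)
qed

end
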